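(* Let $(X_n)_{n\in\omega}$ be a sequence of Tychonoff spaces such that for every $n \in \omega$ all relatively functionally countable (RFC) subsets of $X_n$ are countable. Then all RFC subsets of the product $\prod_{n\in\omega} X_n$ (with the product topology) are countable.
   Context: A subset $A$ of a topological space $X$ is called relatively functionally countable (RFC) in $X$ if for every continuous function $f : X \to \mathbb{R}$ the set $f[A]$ is countable. "Countable" means of cardinality at most $\aleph_0$ (finite sets included). *)

theory Defs
  imports "HOL-Analysis.Analysis"
begin

(* completely_regular_space does not include a separation axiom. *)
definition tychonoff_space :: "'a topology \<Rightarrow> bool" where
  "tychonoff_space X \<longleftrightarrow> completely_regular_space X \<and> Hausdorff_space X"

(* Relatively functionally countable *)
definition rfc_in :: "'a topology \<Rightarrow> 'a set \<Rightarrow> bool" where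
  "rfc_in X A \<longleftrightarrow>
     A \<subseteq> topspace X \<and>
     (\<forall>f :: 'a \<Rightarrow> real. continuous_map X euclideanreal f \<longrightarrow> countable (f ` A))"

end

theory Submission
  imports Defs
begin

text \<open>
  Countably many real functions separate the points of \<open>A\<close>, since every coordinate of \<open>A\<close> ranges
  over a countable set. From them one builds two continuous functions \<open>g\<^sub>0 = v\<^sub>0 + v\<^sub>2 + \<dots>\<close> and
  \<open>g\<^sub>1 = v\<^sub>1 + v\<^sub>3 + \<dots>\<close> that are jointly injective on \<open>A\<close>; as both images of \<open>A\<close> are
  countable, so is \<open>A\<close>. The point \<open>(g\<^sub>0, g\<^sub>1)\<close> moves in a dendrite in the plane: each \<open>v\<^sub>n\<close> is locally
  constant near \<open>A\<close>, and at each of its countably many values on \<open>A\<close> a perpendicular branch is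
  attached, along which \<open>v\<^sub>n\<^sub>+\<^sub>1\<close> moves. Branches are kept disjoint by choosing the length of each one
  small compared with the distances to the finitely many enumerated before it; this is
  compatible with continuity because \<open>v\<^sub>n\<^sub>+\<^sub>1\<close> vanishes wherever \<open>v\<^sub>n\<close> is not locally constant.
\<close>

section \<open>Auxiliary functions: plateaus, damped products, weights, generic coefficients\<close>

text \<open>The points of \<open>T\<close> are treated one after another, the moves being summable
  with total \<open>e\<close>, so the stages converge uniformly. Each stage is a function of the
  previous value alone, so an interval once collapsed to a point stays collapsed in the limit. The
  function \<open>s\<close> then serves as a continuous cutoff that is positive on \<open>T\<close>
  and vanishes wherever \<open>p\<close> is not locally constant.\<close>

lemma ex_plateau_function:
  fixes T :: "real set" and e :: real
  assumes T: "countable T" and e: "e > 0"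
  obtains p :: "real \<Rightarrow> real" and s :: "real \<Rightarrow> real"
  where "continuous_on UNIV p" "\<And>y. \<bar>p y - y\<bar> \<le> e"
    "continuous_on UNIV s" "\<And>y. 0 \<le> s y" "\<And>y. s y \<le> 1" "\<And>t. t \<in> T \<Longrightarrow> s t > 0"
    "\<And>y. s y > 0 \<Longrightarrow> eventually (\<lambda>z. p z = p y) (nhds y)"
proof -
  \<comment> \<open>Adding \<open>0\<close> makes the enumerated set nonempty.\<close>
  define t where "t = from_nat_into (insert 0 T)"
  have t_range: "T \<subseteq> range t"
    using T by (metis countable_insert insert_not_empty range_from_nat_into subset_insertI t_def)
  define d where "d n = e * (1/2) ^ Suc n" for n :: nat
  have d_pos: "d n > 0" for n
    using e by (simp add: d_def)
  have d_sums: "d sums e"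
    using sums_mult[OF power_half_series, of e] by (simp add: d_def[abs_def])
  \<comment> \<open>Each step collapses a small interval around the image of \<open>t n\<close> to a point.\<close>
  define u where "u = rec_nat (\<lambda>y. y) (\<lambda>n w y. w y - max (- d n) (min (d n) (w y - w (t n))))"
  have u_0: "u 0 y = y" for y
    by (simp add: u_def)
  have u_Suc: "u (Suc n) y = u n y - max (- d n) (min (d n) (u n y - u n (t n)))" for n y
    by (simp add: u_def)
  have u_cont: "continuous_on UNIV (u n)" for n
  proof (induction n)
    case 0
    then show ?case by (simp add: u_0[abs_def])
  next
    case (Suc n)
    show ?case
      unfolding u_Suc[abs_def] by (intro continuous_intros Suc)
  qed
  have u_step: "\<bar>u (Suc n) y - u n y\<bar> \<le> d n" for n y
    using d_pos[of n] by (auto simp: u_Suc)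
  have u_tele: "(\<Sum>k<n. u (Suc k) y - u k y) = u n y - y" for n y
    using sum_lessThan_telescope[of "\<lambda>k. u k y" n] by (simp add: u_0)
  have unif: "uniform_limit UNIV (\<lambda>n y. \<Sum>k<n. u (Suc k) y - u k y)
      (\<lambda>y. \<Sum>k. u (Suc k) y - u k y) sequentially"
    by (rule Weierstrass_m_test[where M = d]) (use u_step d_sums in \<open>auto simp: sums_iff\<close>)
  define p where "p y = y + (\<Sum>k. u (Suc k) y - u k y)" for y
  have "continuous_on UNIV (\<lambda>y. \<Sum>k. u (Suc k) y - u k y)"
    by (rule uniform_limit_theorem[OF _ unif]) (auto simp: u_tele intro!: always_eventually continuous_on_diff u_cont continuous_on_id)
  then have p_cont: "continuous_on UNIV p"
    unfolding p_def by (intro continuous_intros)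
  have p_lim: "(\<lambda>n. u n y) \<longlonglongrightarrow> p y" for y
    using tendsto_add[OF tendsto_const[of y] tendsto_uniform_limitI[OF unif, of y]]
    by (simp add: u_tele p_def)
  have p_close: "\<bar>p y - y\<bar> \<le> e" for y
  proof -
    have s: "summable (\<lambda>k. \<bar>u (Suc k) y - u k y\<bar>)"
      by (rule summable_comparison_test[where g = d]) (use u_step d_sums in \<open>auto simp: sums_iff\<close>)
    have "\<bar>p y - y\<bar> \<le> (\<Sum>k. \<bar>u (Suc k) y - u k y\<bar>)"
      unfolding p_def using summable_rabs[OF s] by simp
    also have "\<dots> \<le> e"
      using suminf_le[OF u_step s] d_sums by (auto simp: sums_iff)
    finally show ?thesis .
  qed
  define U where "U = {y. eventually (\<lambda>z. p z = p y) (nhds y)}"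
  have U_open: "open U"
  proof (subst open_subopen, intro ballI)
    fix y assume "y \<in> U"
    then obtain V where V: "open V" "y \<in> V" "\<And>z. z \<in> V \<Longrightarrow> p z = p y"
      by (auto simp: U_def eventually_nhds)
    have "V \<subseteq> U"
    proof
      fix z assume z: "z \<in> V"
      then have "\<forall>w\<in>V. p w = p z" using V(3) by simp
      then show "z \<in> U"
        unfolding U_def eventually_nhds using V(1) z by blast
    qed
    with V show "\<exists>T. open T \<and> y \<in> T \<and> T \<subseteq> U" by blast
  qed
  have U_T: "T \<subseteq> U"
  proof
    fix x assume "x \<in> T"
    then obtain n where n: "x = t n" using t_range by auto
    have "isCont (u n) x"
      using u_cont by (simp add: continuous_on_eq_continuous_at)
    then have "eventually (\<lambda>z. dist (u n z) (u n x) < d n) (nhds x)"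
      unfolding continuous_at tendsto_at_iff_tendsto_nhds using d_pos by (rule tendstoD)
    then have "eventually (\<lambda>z. p z = p x) (nhds x)"
    proof eventually_elim
      case (elim z)
      \<comment> \<open>Within distance \<open>d n\<close> the truncation is inactive, so stage
        \<open>Suc n\<close> sends \<open>z\<close> to \<open>u n (t n)\<close>, just as it does
        \<open>x\<close>.\<close>
      have "u m z = u m x" if "m \<ge> Suc n" for m
        using that
      proof (induction rule: dec_induct)
        case base
        show ?case using elim d_pos[of n] by (auto simp: u_Suc n dist_real_def)
      next
        case (step m)
        then show ?case by (simp add: u_Suc)
      qed
      then have "eventually (\<lambda>m. u m z = u m x) sequentially"
        by (auto simp: eventually_sequentially)
      then have "(\<lambda>m. u m x) \<longlonglongrightarrow> p z"
        using p_lim[of z] by (rule Lim_transform_eventually[rotated])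
      then show ?case
        using p_lim[of x] LIMSEQ_unique by blast
    qed
    then show "x \<in> U" by (simp add: U_def)
  qed
  \<comment> \<open>The case \<open>U = UNIV\<close> is separate because \<open>infdist\<close> to
    the empty set is 0.\<close>
  define s where "s y = (if U = UNIV then 1 else min 1 (infdist y (- U)))" for y
  have s_cont: "continuous_on UNIV s"
    by (cases "U = UNIV") (auto simp: s_def[abs_def] intro!: continuous_intros)
  have s_iff: "s y > 0 \<longleftrightarrow> y \<in> U" for y
  proof (cases "U = UNIV")
    case False
    then have "infdist y (- U) = 0 \<longleftrightarrow> y \<in> - U"
      using U_open in_closed_iff_infdist_zero[of "- U" y] by auto
    then show ?thesis
      using False infdist_nonneg[of y "- U"] by (auto simp: s_def)
  qed (simp add: s_def)
  show thesis
  proof (rule that[of p s, OF p_cont p_close s_cont])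
    show "0 \<le> s y" "s y \<le> 1" for y
      by (auto simp: s_def infdist_nonneg)
    show "s y > 0" if "y \<in> T" for y
      using that U_T s_iff by blast
    show "eventually (\<lambda>z. p z = p y) (nhds y)" if "s y > 0" for y
      using that s_iff by (simp add: U_def)
  qed
qed

text \<open>At a zero of \<open>h\<close> the product is squeezed by \<open>h\<close>, so
  \<open>k\<close> may behave arbitrarily there. This admits factors such as those built from
  \<open>ln (h x)\<close>, which are controlled only where \<open>h\<close> is positive.\<close>

lemma continuous_on_mult_bounded:
  fixes h k :: "'b::t2_space \<Rightarrow> real"
  assumes h: "continuous_on UNIV h" and nonneg: "\<And>x. 0 \<le> h x"
    and k: "\<And>x. h x > 0 \<Longrightarrow> isCont k x" and bound: "\<And>x. h x > 0 \<Longrightarrow> \<bar>k x\<bar> \<le> 1"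
  shows "continuous_on UNIV (\<lambda>x. h x * k x)"
proof -
  have "isCont (\<lambda>x. h x * k x) x" for x
  proof (cases "h x > 0")
    case True
    then show ?thesis
      using h k by (auto intro!: continuous_intros simp: continuous_on_eq_continuous_at)
  next
    case False
    then have 0: "h x = 0" using nonneg[of x] by simp
    have lim: "(h \<longlongrightarrow> 0) (at x)"
      using h 0 by (metis UNIV_I continuous_on_def)
    have "norm (h y * k y) \<le> h y" for y
      using nonneg[of y] bound[of y]
      by (cases "h y = 0") (auto simp: abs_mult intro!: mult_left_le)
    then have "((\<lambda>y. h y * k y) \<longlongrightarrow> 0) (at x)"
      by (intro Lim_null_comparison[OF _ lim] always_eventually allI)
    then show ?thesis
      by (simp add: isCont_def 0)
  qed
  then show ?thesis
    by (simp add: continuous_on_eq_continuous_at)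
qed

text \<open>Along an enumeration of \<open>C\<close>, the weight of a point is at most
  \<open>c\<close> times its distance to each of the finitely many earlier points. Of any two
  points, the later one meets the bound.\<close>

lemma ex_separating_weight:
  fixes C :: "real set" and c :: real
  assumes C: "countable C" and c: "c > 0"
  obtains w :: "real \<Rightarrow> real"
  where "\<And>r. 0 < w r" "\<And>r. w r \<le> 1"
    "\<And>r r'. r \<in> C \<Longrightarrow> r' \<in> C \<Longrightarrow> r \<noteq> r' \<Longrightarrow> min (w r) (w r') \<le> c * \<bar>r - r'\<bar>"
proof -
  define i where "i = to_nat_on C"
  have inj: "inj_on i C"
    using C by (simp add: i_def inj_on_to_nat_on)
  define N where "N r = {q \<in> C. i q < i r}" for r
  have fin: "finite (N r)" for r
  proof (rule finite_imageD)
    show "finite (i ` N r)" by (rule finite_subset[of _ "{..<i r}"]) (auto simp: N_def)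
    show "inj_on i (N r)" using inj by (auto simp: N_def inj_on_def)
  qed
  define w where "w r = Min (insert 1 ((\<lambda>q. c * \<bar>q - r\<bar>) ` N r))" for r
  have "w r > 0" for r
    using fin c by (auto simp: w_def N_def intro!: mult_pos_pos)
  moreover have "w r \<le> 1" for r
    using fin by (simp add: w_def)
  moreover have w_le: "w r \<le> c * \<bar>q - r\<bar>" if "q \<in> C" "i q < i r" for q r
    unfolding w_def using that fin by (intro Min_le) (auto simp: N_def)
  moreover have "min (w r) (w r') \<le> c * \<bar>r - r'\<bar>" if "r \<in> C" "r' \<in> C" "r \<noteq> r'" for r r'
  proof -
    have "i r < i r' \<or> i r' < i r"
      using inj that by (metis inj_onD linorder_neqE_nat)
    then show ?thesis
      using w_le[of r r'] w_le[of r' r] that by (auto simp: abs_minus_commute min_le_iff_disj)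
  qed
  ultimately show thesis using that by blast
qed

text \<open>A collision with \<open>t \<noteq> t'\<close> determines \<open>c\<close> as a quotient
  of differences; only countably many values arise, while the unit interval is uncountable.\<close>

lemma ex_generic_coefficient:
  fixes S T :: "real set"
  assumes "countable S" "countable T"
  obtains c :: real where "0 < c" "c < 1" "inj_on (\<lambda>(s, t). s + c * t) (S \<times> T)"
proof -
  define B where "B = (\<lambda>(s, s', t, t'). (s - s') / (t' - t)) ` (S \<times> S \<times> T \<times> T)"
  have "countable B"
    using assms by (auto simp: B_def)
  moreover have "uncountable {0<..<1::real}"
    by (rule uncountable_open_interval[THEN iffD2]) simp
  ultimately have "\<not> {0<..<1} \<subseteq> B"
    using countable_subset by blast
  then obtain c where "c \<in> {0<..<1}" and c: "c \<notin> B" by blast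
  then have c01: "0 < c" "c < 1" by auto
  have "inj_on (\<lambda>(s, t). s + c * t) (S \<times> T)"
  proof (rule inj_onI, clarify)
    fix s t s' t'
    assume m: "s \<in> S" "t \<in> T" "s' \<in> S" "t' \<in> T" and eq: "s + c * t = s' + c * t'"
    have "t = t'"
    proof (rule ccontr)
      assume "t \<noteq> t'"
      then have "c = (s - s') / (t' - t)" using eq by (simp add: field_simps)
      then have "c \<in> B" using m by (force simp: B_def)
      then show False using c by simp
    qed
    then show "s = s' \<and> t = t'" using eq by simp
  qed
  with c01 that show thesis by blast
qed

section \<open>Decoding a sequence from its even and odd sums\<close>

text \<open>Let \<open>n\<close> be the first index of disagreement and \<open>M\<close> the larger
  of the two entries at \<open>Suc n\<close>. The sum of the parity of \<open>Suc n\<close> forces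
  these entries to be within \<open>M / 63\<close> of each other, so both are at least
  \<open>M / 2\<close>. The sum of the parity of \<open>n\<close> makes
  \<open>\<bar>a n - b n\<bar>\<close> at most \<open>8 * M / 63\<close>, and \<open>gap\<close>
  then bounds the smaller entry by \<open>M / 63\<close>, a contradiction.\<close>

lemma interleaved_sums_determine_sequence:
  fixes a b :: "nat \<Rightarrow> real"
  assumes pos: "\<And>n. 0 < a n" "\<And>n. 0 < b n"
    and decay: "\<And>n. a (Suc n) \<le> a n / 8" "\<And>n. b (Suc n) \<le> b n / 8"
    and gap: "\<And>n. a n \<noteq> b n \<Longrightarrow> min (a (Suc n)) (b (Suc n)) \<le> \<bar>a n - b n\<bar> / 8"
    and even: "(\<Sum>n. a (2 * n)) = (\<Sum>n. b (2 * n))"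
    and odd: "(\<Sum>n. a (Suc (2 * n))) = (\<Sum>n. b (Suc (2 * n)))"
  shows "a = b"
proof (rule ccontr)
  define D where "D c \<longleftrightarrow> (\<forall>n. 0 < c n \<and> c (Suc n) \<le> c n / 8)" for c :: "nat \<Rightarrow> real"
  have D: "D a" "D b" using pos decay by (auto simp: D_def)
  have bound: "c (m + 2 * k) \<le> c m * (1/64) ^ k" if "D c" for c m k
  proof (induction k)
    case (Suc k)
    have "c (m + 2 * Suc k) \<le> c (Suc (m + 2 * k)) / 8" using \<open>D c\<close> by (simp add: D_def)
    also have "\<dots> \<le> c (m + 2 * k) / 64"
      using \<open>D c\<close>[unfolded D_def, rule_format, of "m + 2 * k"] by simp
    finally show ?case using Suc by simp
  qed simp
  have geo: "(\<lambda>k. x * (1/64) ^ k) sums (x * (64/63))" for x :: real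
    using sums_mult[OF geometric_sums[of "1/64::real"], of x] by simp
  have nonneg: "0 \<le> c n" if "D c" for c n
    using that by (simp add: D_def less_imp_le)
  have summ: "summable (\<lambda>k. c (m + 2 * k))" if "D c" for c m
    by (rule summable_comparison_test[OF _ sums_summable[OF geo[of "c m"]]])
       (use bound[OF that] nonneg[OF that] in auto)
  have tail: "0 \<le> (\<Sum>k. c (m + 2 * k)) \<and> (\<Sum>k. c (m + 2 * k)) \<le> c m * (64/63)"
    if "D c" for c m
    using suminf_le[OF bound[OF that] summ[OF that] sums_summable[OF geo[of "c m"]]]
      suminf_nonneg[OF summ[OF that] nonneg[OF that]] geo[of "c m"]
    by (auto simp: sums_iff)
  have split: "(\<Sum>k. c (m + 2 * k)) = c m + (\<Sum>k. c (m + 2 + 2 * k))" if "D c" for c m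
    using suminf_split_head[OF summ[OF that, of m]] by (simp add: algebra_simps)
  assume "a \<noteq> b"
  then have ex: "\<exists>n. a n \<noteq> b n" by auto
  define n where "n = (LEAST n. a n \<noteq> b n)"
  have n: "a n \<noteq> b n" unfolding n_def using ex by (rule LeastI_ex)
  have eq_below: "a m = b m" if "m < n" for m
    using that not_less_Least unfolding n_def by blast
  \<comment> \<open>The range reaches \<open>Suc n\<close>: passing from \<open>l\<close> to
    \<open>l + 2\<close> cancels the entries at \<open>l\<close>, which agree as long as
    \<open>l < n\<close>.\<close>
  have tails_eq: "(\<Sum>k. a (m + 2 * k)) = (\<Sum>k. b (m + 2 * k))" if "m \<le> Suc n" for m
    using that
  proof (induction m rule: less_induct)
    case (less m)
    consider "m = 0" | "m = 1" | l where "m = l + 2"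
      by (metis One_nat_def add_2_eq_Suc' not0_implies_Suc)
    then show ?case
    proof cases
      case 3
      have "a l = b l" using 3 less.prems eq_below by simp
      moreover have "(\<Sum>k. a (l + 2 * k)) = (\<Sum>k. b (l + 2 * k))"
        using less 3 by simp
      ultimately show ?thesis
        using split[OF D(1), of l] split[OF D(2), of l] 3 by simp
    qed (use even odd in auto)
  qed
  define M where "M = max (a (Suc n)) (b (Suc n))"
  have M: "M > 0" "a (Suc n) \<le> M" "b (Suc n) \<le> M" using pos by (auto simp: M_def less_max_iff_disj)
  have small: "c (n + 2) \<le> M / 8" "c (Suc n + 2) \<le> M / 64"
    if "\<And>n. c (Suc n) \<le> c n / 8" "c (Suc n) \<le> M" for c :: "nat \<Rightarrow> real"
    using that(1)[of "Suc n"] that(1)[of "n + 2"] that(2) by (auto simp: numeral_eq_Suc)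
  have A: "\<bar>a n - b n\<bar> \<le> M / 8 * (64/63)"
    using tails_eq[of n] split[OF D(1), of n] split[OF D(2), of n]
      tail[OF D(1), of "n + 2"] tail[OF D(2), of "n + 2"]
      small(1)[OF decay(1) M(2)] small(1)[OF decay(2) M(3)] by linarith
  have B: "\<bar>a (Suc n) - b (Suc n)\<bar> \<le> M / 64 * (64/63)"
    using tails_eq[of "Suc n"] split[OF D(1), of "Suc n"] split[OF D(2), of "Suc n"]
      tail[OF D(1), of "Suc n + 2"] tail[OF D(2), of "Suc n + 2"]
      small(2)[OF decay(1) M(2)] small(2)[OF decay(2) M(3)]
    by linarith
  have "min (a (Suc n)) (b (Suc n)) \<ge> M / 2"
    using B M by (auto simp: M_def min_def max_def split: if_splits)
  then have "M / 2 \<le> M / 8 * (64/63) / 8" using order_trans[OF _ gap[OF n]] A by fastforce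
  then show False using M(1) by simp
qed

section \<open>One branching step\<close>

text \<open>Here \<open>h\<close> limits the size of the new coordinate \<open>v\<close>, whose
  value on \<open>A\<close> determines \<open>f\<close> up to \<open>e\<close>, and
  \<open>h'\<close> limits the size of the coordinate after it. The bound on
  \<open>min (h' a) (h' b)\<close> keeps branches at distinct values of \<open>v\<close>
  apart.\<close>

lemma refine_amplitude:
  fixes A :: "'b::t2_space set" and h f :: "'b \<Rightarrow> real"
  assumes rfc: "\<And>g :: 'b \<Rightarrow> real. continuous_on UNIV g \<Longrightarrow> countable (g ` A)"
    and h: "continuous_on UNIV h" "\<And>x. 0 \<le> h x" "\<And>x. h x \<le> 1" "\<And>x. x \<in> A \<Longrightarrow> 0 < h x"
    and f: "continuous_on UNIV f" "\<And>x. \<bar>f x\<bar> \<le> 1"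
    and e: "0 < e" "e \<le> 1"
  obtains v h' :: "'b \<Rightarrow> real"
  where "continuous_on UNIV v" "\<And>x. 0 \<le> v x" "\<And>x. v x \<le> h x" "\<And>x. x \<in> A \<Longrightarrow> 0 < v x"
    "continuous_on UNIV h'" "\<And>x. 0 \<le> h' x" "\<And>x. h' x \<le> v x / 8" "\<And>x. x \<in> A \<Longrightarrow> 0 < h' x"
    "\<And>a b. a \<in> A \<Longrightarrow> b \<in> A \<Longrightarrow> v a \<noteq> v b \<Longrightarrow> min (h' a) (h' b) \<le> \<bar>v a - v b\<bar> / 8"
    "\<And>a b. a \<in> A \<Longrightarrow> b \<in> A \<Longrightarrow> v a = v b \<Longrightarrow> \<bar>f a - f b\<bar> \<le> e"
proof -
  have "countable ((\<lambda>x. ln (h x)) ` A)"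
    using countable_image[OF rfc[OF h(1)], of ln] by (simp add: image_image)
  then obtain p s where p: "continuous_on UNIV p" "\<And>y. \<bar>p y - y\<bar> \<le> (1::real)"
    and s: "continuous_on UNIV s" "\<And>y. 0 \<le> s y" "\<And>y. s y \<le> (1::real)"
      "\<And>t. t \<in> (\<lambda>x. ln (h x)) ` A \<Longrightarrow> s t > 0"
      "\<And>y. s y > 0 \<Longrightarrow> eventually (\<lambda>z. p z = p y) (nhds y)"
    using ex_plateau_function[of _ 1] zero_less_one by metis
  have "countable (f ` A)" "e / 2 > 0"
    using rfc f e by auto
  then obtain q t where q: "continuous_on UNIV q" "\<And>y. \<bar>q y - y\<bar> \<le> e / 2"
    and t: "continuous_on UNIV t" "\<And>y. 0 \<le> t y" "\<And>y. t y \<le> (1::real)"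
      "\<And>y. y \<in> f ` A \<Longrightarrow> t y > 0"
      "\<And>y. t y > 0 \<Longrightarrow> eventually (\<lambda>z. q z = q y) (nhds y)"
    using ex_plateau_function by metis
  obtain c where c: "0 < c" "c < 1"
    "inj_on (\<lambda>(s, t). s + c * t) (p ` (\<lambda>x. ln (h x)) ` A \<times> q ` f ` A)"
    using ex_generic_coefficient \<open>countable ((\<lambda>x. ln (h x)) ` A)\<close> \<open>countable (f ` A)\<close>
    by (metis countable_image)
  \<comment> \<open>A logarithmic plateau function keeps \<open>v\<close> positive wherever \<open>h\<close> is; by the choice of \<open>c\<close>
    the values of \<open>v\<close> on \<open>A\<close> still determine those of \<open>q \<circ> f\<close>. Note \<open>v x = 0\<close> if \<open>h x = 0\<close>.\<close>
  define k where "k x = exp (p (ln (h x)) - ln (h x) + c * q (f x) - 3)" for x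
  define v where "v x = h x * k x" for x
  have v_eq: "v x = exp (p (ln (h x)) + c * q (f x) - 3)" if "h x > 0" for x
  proof -
    have "v x = exp (ln (h x)) * k x" using that by (simp add: v_def)
    also have "\<dots> = exp (p (ln (h x)) + c * q (f x) - 3)"
      unfolding k_def exp_add[symmetric] by (simp add: algebra_simps)
    finally show ?thesis .
  qed
  \<comment> \<open>The \<open>- 3\<close> in \<open>k\<close> absorbs the plateau error of
    \<open>p\<close>, at most 1, and \<open>c * q (f x)\<close>, at most 2; hence \<open>v\<close>
    stays below \<open>h\<close>.\<close>
  have k_bound: "0 < k x" "k x \<le> 1" for x
  proof -
    have "q (f x) \<le> 2"
      using q(2)[of "f x"] f(2)[of x] e by linarith
    then have "c * q (f x) \<le> c * 2"
      using c by (intro mult_left_mono) auto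
    then have "p (ln (h x)) - ln (h x) + c * q (f x) - 3 \<le> 0"
      using p(2)[of "ln (h x)"] c by linarith
    then show "0 < k x" "k x \<le> 1" by (simp_all add: k_def)
  qed
  have cont_at: "isCont p y" "isCont s y" "isCont q y" "isCont t y" for y
    using p q s t by (simp_all add: continuous_on_eq_continuous_at)
  have f_at: "isCont f x" for x
    using f by (simp add: continuous_on_eq_continuous_at)
  have ln_h: "isCont (\<lambda>x. ln (h x)) x" if "h x > 0" for x
    using h that by (intro continuous_intros) (auto simp: continuous_on_eq_continuous_at)
  have v_cont: "continuous_on UNIV v"
    unfolding v_def
  proof (rule continuous_on_mult_bounded[OF h(1,2)])
    fix x assume x: "h x > 0"
    show "isCont k x"
      unfolding k_def
      by (intro continuous_intros ln_h x isCont_o2[OF ln_h[OF x] cont_at(1)] isCont_o2[OF f_at cont_at(3)])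
    show "\<bar>k x\<bar> \<le> 1" using k_bound[of x] by simp
  qed
  have v_nonneg: "0 \<le> v x" and v_le: "v x \<le> h x" for x
    using h(2)[of x] k_bound[of x] by (auto simp: v_def intro: mult_left_le)
  have h_pos: "h x > 0" if "v x > 0" for x
    using that v_le[of x] by linarith
  \<comment> \<open>The cutoffs \<open>s\<close> and \<open>t\<close> vanish off the plateaus of
    \<open>p\<close> and \<open>q\<close>, so \<open>g x > 0\<close> forces \<open>v\<close> to be
    locally constant at \<open>x\<close>; on \<open>A\<close> both are positive.\<close>
  define g where "g x = v x * (s (ln (h x)) * t (f x))" for x
  have st: "0 \<le> s y * t z" "s y * t z \<le> 1" for y z
    using s(2,3)[of y] t(2,3)[of z] by (auto simp: mult_le_one)
  have g_cont: "continuous_on UNIV g"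
    unfolding g_def
  proof (rule continuous_on_mult_bounded[OF v_cont v_nonneg])
    fix x assume "v x > 0"
    then have x: "h x > 0" by (rule h_pos)
    show "isCont (\<lambda>x. s (ln (h x)) * t (f x)) x"
      by (intro continuous_intros isCont_o2[OF ln_h[OF x] cont_at(2)] isCont_o2[OF f_at cont_at(4)])
    show "\<bar>s (ln (h x)) * t (f x)\<bar> \<le> 1" using st by (simp add: abs_le_iff minus_le_iff order_trans[OF _ st(1)])
  qed
  have g_bound: "0 \<le> g x" "g x \<le> v x" for x
    using v_nonneg[of x] st by (auto simp: g_def intro: mult_left_le)
  have v_local: "eventually (\<lambda>y. v y = v x) (nhds x)" if "g x > 0" for x
  proof -
    have "v x > 0" using that g_bound[of x] by linarith
    then have x: "h x > 0" by (rule h_pos)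
    have "s (ln (h x)) > 0" "t (f x) > 0"
      using that s(2)[of "ln (h x)"] t(2)[of "f x"] v_nonneg[of x]
      by (auto simp: g_def zero_less_mult_iff)
    moreover have "filterlim (\<lambda>y. ln (h y)) (nhds (ln (h x))) (nhds x)"
      using ln_h[OF x] tendsto_at_iff_tendsto_nhds[of "\<lambda>y. ln (h y)" x] by (simp add: continuous_at)
    moreover have "filterlim f (nhds (f x)) (nhds x)"
      using f_at[of x] by (simp add: continuous_at tendsto_at_iff_tendsto_nhds)
    ultimately have "eventually (\<lambda>y. p (ln (h y)) = p (ln (h x))) (nhds x)"
      "eventually (\<lambda>y. q (f y) = q (f x)) (nhds x)"
      by (auto intro: eventually_compose_filterlim[OF s(5)] eventually_compose_filterlim[OF t(5)])
    moreover have "eventually (\<lambda>y. h y > 0) (nhds x)"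
    proof -
      have "filterlim h (nhds (h x)) (nhds x)"
        using h(1) by (simp add: continuous_on_eq_continuous_at continuous_at tendsto_at_iff_tendsto_nhds)
      then show ?thesis using x by (rule order_tendstoD)
    qed
    ultimately show ?thesis
      by eventually_elim (simp add: v_eq x)
  qed
  have "countable (v ` A)" by (rule rfc[OF v_cont])
  then obtain w where w: "\<And>r. 0 < w r" "\<And>r. w r \<le> 1"
    "\<And>r r'. r \<in> v ` A \<Longrightarrow> r' \<in> v ` A \<Longrightarrow> r \<noteq> r' \<Longrightarrow> min (w r) (w r') \<le> 1 * \<bar>r - r'\<bar>"
    using ex_separating_weight[of _ 1] zero_less_one by metis
  \<comment> \<open>The weight \<open>w\<close> is arbitrary, but \<open>v\<close> is locally constant where \<open>g > 0\<close>.\<close>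
  define h' where "h' x = g x * (w (v x) / 8)" for x
  have "continuous_on UNIV h'"
    unfolding h'_def
  proof (rule continuous_on_mult_bounded[OF g_cont g_bound(1)])
    fix x assume x: "g x > 0"
    have "eventually (\<lambda>y. w (v y) / 8 = w (v x) / 8) (nhds x)"
      using v_local[OF x] by eventually_elim simp
    then show "isCont (\<lambda>x. w (v x) / 8) x"
      using isCont_cong by fastforce
    show "\<bar>w (v x) / 8\<bar> \<le> 1" using w(1,2)[of "v x"] by simp
  qed
  moreover have "0 \<le> h' x" for x
    using g_bound[of x] w(1)[of "v x"] by (simp add: h'_def)
  \<comment> \<open>The first bound gives geometric decay; the second, which relies on
    \<open>g \<le> v \<le> h \<le> 1\<close>, hands the separation property of \<open>w\<close> on
    to \<open>h'\<close>.\<close>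
  moreover have h'_le: "h' x \<le> v x / 8" "h' x \<le> w (v x) / 8" for x
  proof -
    have "h' x \<le> g x * (1 / 8)"
      unfolding h'_def using g_bound[of x] w(2)[of "v x"] by (intro mult_left_mono) auto
    then show "h' x \<le> v x / 8" using g_bound[of x] by simp
    have "h' x \<le> 1 * (w (v x) / 8)"
      unfolding h'_def using g_bound[of x] v_le[of x] h(3)[of x] w(1)[of "v x"]
      by (intro mult_right_mono) auto
    then show "h' x \<le> w (v x) / 8" by simp
  qed
  moreover have v_pos: "0 < v x" if "x \<in> A" for x
    using h(4)[OF that] k_bound by (simp add: v_def)
  moreover have "0 < h' x" if "x \<in> A" for x
    using v_pos[OF that] w(1)[of "v x"] s(4) t(4) that by (simp add: h'_def g_def)
  moreover have "min (h' a) (h' b) \<le> \<bar>v a - v b\<bar> / 8"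
    if "a \<in> A" "b \<in> A" "v a \<noteq> v b" for a b
    using w(3)[of "v a" "v b"] h'_le(2)[of a] h'_le(2)[of b] that by (auto simp: min_def split: if_splits)
  moreover have "\<bar>f a - f b\<bar> \<le> e" if "a \<in> A" "b \<in> A" "v a = v b" for a b
  proof -
    have "p (ln (h a)) + c * q (f a) = p (ln (h b)) + c * q (f b)"
      using that v_eq[of a] v_eq[of b] h(4) by simp
    then have "q (f a) = q (f b)"
      using inj_onD[OF c(3), of "(p (ln (h a)), q (f a))" "(p (ln (h b)), q (f b))"] that by auto
    then show ?thesis using q(2)[of "f a"] q(2)[of "f b"] by linarith
  qed
  ultimately show thesis
    using that[of v h'] v_cont v_nonneg v_le by blast
qed

section \<open>Iterating the step and summing the coordinates\<close>

text \<open>Dependent choice iterates \<open>refine_amplitude\<close>. The even and odd sums of the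
  coordinates are continuous and determine all coordinates on \<open>A\<close>, hence every
  \<open>f k\<close> up to arbitrarily small error.\<close>

lemma countable_if_countably_separated:
  fixes A :: "'b::t2_space set" and f :: "nat \<Rightarrow> 'b \<Rightarrow> real"
  assumes rfc: "\<And>g :: 'b \<Rightarrow> real. continuous_on UNIV g \<Longrightarrow> countable (g ` A)"
    and f: "\<And>k. continuous_on UNIV (f k)" "\<And>k x. \<bar>f k x\<bar> \<le> 1"
    and sep: "\<And>a b. a \<in> A \<Longrightarrow> b \<in> A \<Longrightarrow> (\<And>k. f k a = f k b) \<Longrightarrow> a = b"
  shows "countable A"
proof -
  define P :: "('b \<Rightarrow> real) \<times> ('b \<Rightarrow> real) \<Rightarrow> bool" where
    "P = (\<lambda>(v, h). continuous_on UNIV h \<and> (\<forall>x. 0 \<le> h x \<and> h x \<le> 1) \<and> (\<forall>x\<in>A. 0 < h x))"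
  \<comment> \<open>Through \<open>prod_decode\<close> every index \<open>k\<close> is visited at
    infinitely many steps \<open>n\<close>, while the tolerance \<open>1 / real (Suc n)\<close>
    tends to 0.\<close>
  define Q :: "nat \<Rightarrow> ('b \<Rightarrow> real) \<times> ('b \<Rightarrow> real) \<Rightarrow> ('b \<Rightarrow> real) \<times> ('b \<Rightarrow> real) \<Rightarrow> bool" where
    "Q = (\<lambda>n (_, h) (v, h'). continuous_on UNIV v \<and> (\<forall>x. 0 \<le> v x \<and> v x \<le> h x \<and> h' x \<le> v x / 8)
      \<and> (\<forall>x\<in>A. 0 < v x)
      \<and> (\<forall>a\<in>A. \<forall>b\<in>A. v a \<noteq> v b \<longrightarrow> min (h' a) (h' b) \<le> \<bar>v a - v b\<bar> / 8)
      \<and> (\<forall>a\<in>A. \<forall>b\<in>A. v a = v b \<longrightarrow>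
          \<bar>f (fst (prod_decode n)) a - f (fst (prod_decode n)) b\<bar> \<le> 1 / real (Suc n)))"
  have "\<exists>F. \<forall>n. P (F n) \<and> Q n (F n) (F (Suc n))"
  proof (rule dependent_nat_choice)
    show "\<exists>x. P x" by (rule exI[of _ "(\<lambda>_. 1, \<lambda>_. 1)"]) (simp add: P_def)
    fix x :: "('b \<Rightarrow> real) \<times> ('b \<Rightarrow> real)" and n :: nat assume "P x"
    then obtain v0 h where x: "x = (v0, h)" and h: "continuous_on UNIV h" "\<And>x. 0 \<le> h x"
      "\<And>x. h x \<le> 1" "\<And>x. x \<in> A \<Longrightarrow> 0 < h x" by (auto simp: P_def)
    show "\<exists>y. P y \<and> Q n x y"
    proof (rule refine_amplitude[of A h "f (fst (prod_decode n))" "1 / real (Suc n)"])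
      show "countable (g ` A)" if "continuous_on UNIV g" for g :: "'b \<Rightarrow> real"
        using rfc that .
      fix v h' :: "'b \<Rightarrow> real"
      assume v: "continuous_on UNIV v" "\<And>x. 0 \<le> v x" "\<And>x. v x \<le> h x" "\<And>x. x \<in> A \<Longrightarrow> 0 < v x"
        "continuous_on UNIV h'" "\<And>x. 0 \<le> h' x" "\<And>x. h' x \<le> v x / 8" "\<And>x. x \<in> A \<Longrightarrow> 0 < h' x"
        "\<And>a b. a \<in> A \<Longrightarrow> b \<in> A \<Longrightarrow> v a \<noteq> v b \<Longrightarrow> min (h' a) (h' b) \<le> \<bar>v a - v b\<bar> / 8"
        "\<And>a b. a \<in> A \<Longrightarrow> b \<in> A \<Longrightarrow> v a = v b \<Longrightarrow>
          \<bar>f (fst (prod_decode n)) a - f (fst (prod_decode n)) b\<bar> \<le> 1 / real (Suc n)"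
      have "h' y \<le> 1" for y using v(2,3,7)[of y] h(3)[of y] by linarith
      then show ?thesis
        using v by (intro exI[of _ "(v, h')"]) (simp add: P_def Q_def x)
    qed (use h f in auto)
  qed
  then obtain F where F: "\<And>n. P (F n)" "\<And>n. Q n (F n) (F (Suc n))" by blast
  \<comment> \<open>The shift pairs each coordinate with the amplitude it was built from:
    \<open>V n \<le> H n\<close>, and \<open>H (Suc n)\<close> is the amplitude left
    afterwards.\<close>
  define V where "V n = fst (F (Suc n))" for n
  define H where "H n = snd (F n)" for n
  have V_cont: "continuous_on UNIV (V n)" and V_nonneg: "0 \<le> V n x" and V_le: "V n x \<le> H n x"
    and H_le: "H (Suc n) x \<le> V n x / 8" and H_0: "H n x \<le> 1" and V_pos: "x \<in> A \<Longrightarrow> 0 < V n x"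
    and gap: "a \<in> A \<Longrightarrow> b \<in> A \<Longrightarrow> V n a \<noteq> V n b \<Longrightarrow> min (H (Suc n) a) (H (Suc n) b) \<le> \<bar>V n a - V n b\<bar> / 8"
    and near: "a \<in> A \<Longrightarrow> b \<in> A \<Longrightarrow> V n a = V n b \<Longrightarrow>
       \<bar>f (fst (prod_decode n)) a - f (fst (prod_decode n)) b\<bar> \<le> 1 / real (Suc n)" for n x a b
    using F(1)[of n] F(2)[of n] by (auto simp: P_def Q_def V_def H_def split_beta)
  have decay: "V (Suc n) x \<le> V n x / 8" for n x
    using V_le[of "Suc n" x] H_le[of n x] by linarith
  have V_geo: "V n x \<le> (1/8) ^ n" for n x
  proof (induction n)
    case 0
    then show ?case using V_le[of 0 x] H_0[of 0 x] by simp
  next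
    case (Suc n)
    then show ?case using decay[of n x] by simp
  qed
  \<comment> \<open>The condition on \<open>r\<close> covers both the even and the odd indices with
    one geometric majorant.\<close>
  have sum_cont: "continuous_on UNIV (\<lambda>x. \<Sum>n. V (r n) x)" if r: "\<And>n. n \<le> r n" for r :: "nat \<Rightarrow> nat"
  proof (rule uniform_limit_theorem)
    have "\<bar>V (r n) x\<bar> \<le> (1/8) ^ n" for n x
      using order_trans[OF V_geo power_decreasing[OF r]] V_nonneg by simp
    then show "uniform_limit UNIV (\<lambda>m x. \<Sum>n<m. V (r n) x) (\<lambda>x. \<Sum>n. V (r n) x) sequentially"
      by (intro Weierstrass_m_test[where M = "\<lambda>n. (1/8) ^ n"]) (auto intro: summable_geometric)
  qed (auto intro!: always_eventually continuous_intros V_cont)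
  define G where "G x = (\<Sum>n. V (2 * n) x, \<Sum>n. V (Suc (2 * n)) x)" for x
  have "G ` A \<subseteq> (\<lambda>x. \<Sum>n. V (2 * n) x) ` A \<times> (\<lambda>x. \<Sum>n. V (Suc (2 * n)) x) ` A"
    by (auto simp: G_def)
  moreover have "countable \<dots>"
    by (intro countable_SIGMA rfc sum_cont) auto
  ultimately have "countable (G ` A)"
    using countable_subset by blast
  moreover have "inj_on G A"
  proof (rule inj_onI)
    fix a b assume ab: "a \<in> A" "b \<in> A" and eq: "G a = G b"
    have "(\<lambda>n. V n a) = (\<lambda>n. V n b)"
    proof (rule interleaved_sums_determine_sequence)
      show "min (V (Suc n) a) (V (Suc n) b) \<le> \<bar>V n a - V n b\<bar> / 8" if "V n a \<noteq> V n b" for n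
        using gap[OF ab that] V_le[of "Suc n" a] V_le[of "Suc n" b]
        by (auto simp: min_def split: if_splits)
    qed (use ab eq V_pos decay in \<open>auto simp: G_def\<close>)
    then have V_eq: "V n a = V n b" for n by metis
    show "a = b"
    proof (rule sep[OF ab])
      fix k
      \<comment> \<open>Step \<open>prod_encode (k, j)\<close> handles \<open>f k\<close>, and its
        number is at least \<open>j\<close>.\<close>
      have "\<bar>f k a - f k b\<bar> \<le> 1 / real (Suc j)" for j
      proof -
        have "\<bar>f k a - f k b\<bar> \<le> 1 / real (Suc (prod_encode (k, j)))"
          using near[OF ab V_eq, of "prod_encode (k, j)"] by simp
        also have "\<dots> \<le> 1 / real (Suc j)"
          using le_prod_encode_2[of j k] by (intro divide_left_mono) auto
        finally show ?thesis .
      qed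
      then have "\<bar>f k a - f k b\<bar> \<le> 0"
        by (intro LIMSEQ_le_const[OF LIMSEQ_inverse_real_of_nat])
           (auto simp: inverse_eq_divide simp del: of_nat_Suc)
      then show "f k a = f k b" by simp
    qed
  qed
  ultimately show ?thesis by (simp add: countable_image_inj_eq)
qed

section \<open>Transfer to abstract topologies and the countable product\<close>

lemma rfc_in_continuous_map_image:
  assumes "rfc_in X A" "continuous_map X Y g"
  shows "rfc_in Y (g ` A)"
  unfolding rfc_in_def
proof (intro conjI allI impI)
  show "g ` A \<subseteq> topspace Y"
    using assms(1) continuous_map_image_subset_topspace[OF assms(2)] by (auto simp: rfc_in_def)
  fix f :: "'b \<Rightarrow> real" assume "continuous_map Y euclideanreal f"
  then have "continuous_map X euclideanreal (f \<circ> g)"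
    using assms(2) continuous_map_compose by blast
  then show "countable (f ` g ` A)"
    using assms(1) unfolding rfc_in_def by (metis image_comp)
qed

text \<open>The functions \<open>f k\<close> together map \<open>X\<close> continuously into the
  sequence space \<open>nat \<Rightarrow> real\<close> and are injective on \<open>A\<close>. The
  image of \<open>A\<close> is again RFC, and there the type-based result applies with the
  coordinates as separating functions.\<close>

lemma countable_rfc_in_if_countably_separated:
  fixes f :: "nat \<Rightarrow> 'a \<Rightarrow> real"
  assumes A: "rfc_in X A"
    and f: "\<And>k. continuous_map X euclideanreal (f k)"
    and sep: "\<And>a b. a \<in> A \<Longrightarrow> b \<in> A \<Longrightarrow> (\<And>k. f k a = f k b) \<Longrightarrow> a = b"
  shows "countable A"
proof -
  define g where "g x k = f k x" for x k
  have "continuous_map X (product_topology (\<lambda>_. euclideanreal) UNIV) g"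
    using f by (simp add: continuous_map_componentwise_UNIV g_def)
  then have "rfc_in euclidean (g ` A)"
    using rfc_in_continuous_map_image[OF A] by (simp add: euclidean_product_topology)
  then have rfc: "countable (u ` g ` A)" if "continuous_on UNIV u" for u :: "(nat \<Rightarrow> real) \<Rightarrow> real"
    using that by (simp add: rfc_in_def)
  have "countable (g ` A)"
  \<comment> \<open>Halving the injective \<open>arctan\<close> brings the coordinates into
    \<open>[-1, 1]\<close>, since \<open>pi < 4\<close>.\<close>
  proof (rule countable_if_countably_separated[where f = "\<lambda>k y. arctan (y k) / 2"])
    show "countable (u ` g ` A)" if "continuous_on UNIV u" for u :: "(nat \<Rightarrow> real) \<Rightarrow> real"
      using rfc that .
    show "continuous_on UNIV (\<lambda>y :: nat \<Rightarrow> real. arctan (y k) / 2)" for k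
      by (intro continuous_intros) auto
    show "\<bar>arctan (y k) / 2\<bar> \<le> 1" for k and y :: "nat \<Rightarrow> real"
      using arctan_bounded[of "y k"] pi_less_4 by linarith
  qed (auto simp: arctan_eq_iff)
  moreover have "inj_on g A"
    by (rule inj_onI) (metis g_def sep)
  ultimately show ?thesis by (simp add: countable_image_inj_eq)
qed

lemma tychonoff_space_separation:
  assumes "tychonoff_space X" "a \<in> topspace X" "b \<in> topspace X" "a \<noteq> b"
  obtains f :: "'a \<Rightarrow> real" where "continuous_map X euclideanreal f" "f a \<noteq> f b"
proof -
  have "closedin X {b}"
    using assms by (simp add: tychonoff_space_def closedin_Hausdorff_singleton)
  then obtain f where "continuous_map X euclideanreal f" "f a = 0" "f ` {b} \<subseteq> {1}"
    using assms unfolding tychonoff_space_def completely_regular_space_alt by blast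
  then show thesis using that by force
qed

text \<open>Each projection of an RFC set \<open>A\<close> is RFC in its factor, hence countable. So
  there are only countably many pairs of coordinate values to separate, and one continuous function
  for each pair suffices to separate the points of \<open>A\<close>.\<close>

theorem theorem4p1:
  fixes X :: "nat \<Rightarrow> 'a topology"
  assumes "\<And>n. tychonoff_space (X n)"
    and "\<And>n A. rfc_in (X n) A \<Longrightarrow> countable A"
  shows "\<forall>A. rfc_in (product_topology X UNIV) A \<longrightarrow> countable A"
proof (intro allI impI)
  fix A assume A: "rfc_in (product_topology X UNIV) A"
  let ?P = "product_topology X UNIV"
  have proj: "continuous_map ?P (X n) (\<lambda>x. x n)" for n
    by (rule continuous_map_product_projection) simp
  define B where "B n = (\<lambda>x. x n) ` A" for n
  have B_countable: "countable (B n)" for n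
    unfolding B_def using assms(2) rfc_in_continuous_map_image[OF A proj] .
  have B_sub: "B n \<subseteq> topspace (X n)" for n
    using rfc_in_continuous_map_image[OF A proj] by (simp add: rfc_in_def B_def)
  define I where "I = (SIGMA n:UNIV. B n \<times> B n)"
  have ex: "\<exists>f. continuous_map (X n) euclideanreal f \<and> (a \<noteq> b \<longrightarrow> f a \<noteq> (f b :: real))"
    if "a \<in> B n" "b \<in> B n" for n a b
  proof (cases "a = b")
    case True
    then show ?thesis by (intro exI[of _ "\<lambda>_. 0"]) simp
  next
    case False
    moreover have "a \<in> topspace (X n)" "b \<in> topspace (X n)"
      using that B_sub by auto
    ultimately obtain f :: "'a \<Rightarrow> real" where "continuous_map (X n) euclideanreal f" "f a \<noteq> f b"
      using tychonoff_space_separation[OF assms(1)] by metis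
    then show ?thesis by blast
  qed
  define s where "s n a b = (SOME f. continuous_map (X n) euclideanreal f \<and> (a \<noteq> b \<longrightarrow> f a \<noteq> (f b :: real)))"
    for n a b
  have "continuous_map (X n) euclideanreal (s n a b) \<and> (a \<noteq> b \<longrightarrow> s n a b a \<noteq> s n a b b)"
    if "a \<in> B n" "b \<in> B n" for n a b
    unfolding s_def by (rule someI_ex[OF ex[OF that]])
  then have s: "\<And>n a b. a \<in> B n \<Longrightarrow> b \<in> B n \<Longrightarrow> continuous_map (X n) euclideanreal (s n a b)"
    "\<And>n a b. a \<in> B n \<Longrightarrow> b \<in> B n \<Longrightarrow> a \<noteq> b \<Longrightarrow> s n a b a \<noteq> s n a b b"
    by blast+
  \<comment> \<open>The zero function keeps \<open>J\<close> nonempty when \<open>A\<close> is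
    empty, so that \<open>from_nat_into J\<close> takes values in \<open>J\<close>.\<close>
  define J where "J = insert (\<lambda>_. 0) ((\<lambda>(n, a, b) x. s n a b (x n)) ` I)"
  have J: "countable J" "J \<noteq> {}"
    using B_countable by (auto simp: J_def I_def)
  have J_cont: "continuous_map ?P euclideanreal f" if "f \<in> J" for f
    using that continuous_map_compose[OF proj s(1)] by (auto simp: J_def I_def o_def)
  show "countable A"
  proof (rule countable_rfc_in_if_countably_separated[OF A, of "from_nat_into J"])
    show "continuous_map ?P euclideanreal (from_nat_into J k)" for k
      by (intro J_cont from_nat_into J)
    show "a = b" if ab: "a \<in> A" "b \<in> A" and eq: "\<And>k. from_nat_into J k a = from_nat_into J k b" for a b
    proof
      fix n
      have m: "a n \<in> B n" "b n \<in> B n" using ab by (auto simp: B_def)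
      then have "(\<lambda>x. s n (a n) (b n) (x n)) \<in> J"
        by (force simp: J_def I_def)
      then have "s n (a n) (b n) (a n) = s n (a n) (b n) (b n)"
        using eq J(1) by (metis from_nat_into_surj)
      then show "a n = b n" using s(2) m by blast
    qed
  qed
qed

end
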